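(* Let $k\ge2$, $\rho\ge1$ with $\rho<m/(k-1)$, and let $\mathcal{C}$ be a non-degenerate $[m+\rho,k]_{q^m/q}$ code such that $\mathcal{C}^\perp$ is non-degenerate, with associated system $U_{\mathcal{C}}\subseteq\mathbb{F}_{q^m}^k$. Then $\mathcal{C}$ is quasi-MRD if and only if $\varepsilon_{U_{\mathcal{C}}}(k-1)=\rho$; $\mathcal{C}^\perp$ is quasi-MRD if and only if $U_{\mathcal{C}}$ is $(k-2)$-scattered. Hence $\mathcal{C}$ is dually quasi-MRD if and only if $U_{\mathcal{C}}$ is $(k-2)$-scattered and $\varepsilon_{U_{\mathcal{C}}}(k-1)=\rho$.
   Context: An $[n,k]_{q^m/q}$ code is a $k$-dim $\mathbb{F}_{q^m}$-subspace of $\mathbb{F}_{q^m}^n$ with the rank metric (rank weight of $v$ is $\dim_{\mathbb{F}_q}\langle v_1,\dots,v_n\rangle_{\mathbb{F}_q}$); $\mathcal{C}^\perp$ is the dual w.r.t. the standard bilinear form. Non-degenerate: columns of a generator matrix are $\mathbb{F}_q$-linearly independent; $U_{\mathcal{C}}$ is the $\mathbb{F}_q$-span of these columns. For $n>m$ with $n\nmid mk$, an $[n,k]_{q^m/q}$ code is quasi-MRD if its minimum distance is $m-\lceil km/n\rceil+1$; $\mathcal{C}$ is dually quasi-MRD if $\mathcal{C}$ and $\mathcal{C}^\perp$ are both quasi-MRD. For an $\mathbb{F}_q$-subspace $U$ of $\mathbb{F}_{q^m}^k$: $\varepsilon_U(T)=\dim_{\mathbb{F}_q}(U\cap T)-\dim_{\mathbb{F}_{q^m}}T$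 and $\varepsilon_U(r)=\max\{\varepsilon_U(T):\dim_{\mathbb{F}_{q^m}}T=r\}$. $U$ is $h$-scattered if $\dim_{\mathbb{F}_q}(U\cap T)\le h$ for all $h$-dimensional $\mathbb{F}_{q^m}$-subspaces $T$ (vacuous for $h=0$). *)

theory Defs
  imports "HOL-Analysis.Analysis"
begin

text \<open>
  The extension \<open>\<bbbF>\<^bsub>q^m\<^esub>/\<bbbF>\<^bsub>q\<^esub>\<close> is given by two finite fields \<open>'q\<close>, \<open>'l\<close> and a field homomorphism
  \<open>\<iota> :: 'q \<Rightarrow> 'l\<close> (automatically injective). Linear algebra over \<open>'l\<close> is that of the interpretation
  \<open>vec\<close> of the library; linear algebra over \<open>'q\<close> is obtained from the locale \<^locale>\<open>vector_space\<close>
  with the scalar multiplications restricted along \<open>\<iota>\<close>.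
\<close>

definition field_embedding :: "('q::field \<Rightarrow> 'l::field) \<Rightarrow> bool" where
  "field_embedding \<iota> \<longleftrightarrow>
     \<iota> 1 = 1 \<and> (\<forall>x y. \<iota> (x + y) = \<iota> x + \<iota> y) \<and> (\<forall>x y. \<iota> (x * y) = \<iota> x * \<iota> y)"

definition scale_elem :: "('q::field \<Rightarrow> 'l::field) \<Rightarrow> 'q \<Rightarrow> 'l \<Rightarrow> 'l" where
  "scale_elem \<iota> c x = \<iota> c * x"

definition scale_vec :: "('q::field \<Rightarrow> 'l::field) \<Rightarrow> 'q \<Rightarrow> 'l ^ 'n \<Rightarrow> 'l ^ 'n" where
  "scale_vec \<iota> c v = \<iota> c *s v"

lemma vector_space_scale_elem: "field_embedding \<iota> \<Longrightarrow> vector_space (scale_elem \<iota>)"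
  by unfold_locales (auto simp: field_embedding_def scale_elem_def algebra_simps)

lemma vector_space_scale_vec: "field_embedding \<iota> \<Longrightarrow> vector_space (scale_vec \<iota>)"
  by unfold_locales
    (auto simp: field_embedding_def scale_vec_def vec_eq_iff algebra_simps)

definition ext_degree :: "('q::field \<Rightarrow> 'l::field) \<Rightarrow> nat" where
  "ext_degree \<iota> = vector_space.dim (scale_elem \<iota>) UNIV"

abbreviation subfield_dim :: "('q::field \<Rightarrow> 'l::field) \<Rightarrow> ('l ^ 'n) set \<Rightarrow> nat" where
  "subfield_dim \<iota> \<equiv> vector_space.dim (scale_vec \<iota>)"

definition rank_weight :: "('q::field \<Rightarrow> 'l::field) \<Rightarrow> 'l ^ 'n \<Rightarrow> nat" where
  "rank_weight \<iota> v =
     vector_space.dim (scale_elem \<iota>) (module.span (scale_elem \<iota>) (range (\<lambda>i. v $ i)))"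

definition min_distance :: "('q::field \<Rightarrow> 'l::field) \<Rightarrow> ('l ^ 'n) set \<Rightarrow> nat" where
  "min_distance \<iota> C = Min {rank_weight \<iota> (x - y) | x y. x \<in> C \<and> y \<in> C \<and> x \<noteq> y}"

definition is_code :: "nat \<Rightarrow> ('l::field ^ 'n) set \<Rightarrow> bool" where
  "is_code k C \<longleftrightarrow> vec.subspace C \<and> vec.dim C = k"

definition dual_code :: "('l::field ^ 'n) set \<Rightarrow> ('l ^ 'n) set" where
  "dual_code C = {v. \<forall>c\<in>C. scalar_product v c = 0}"

definition generator_matrix :: "'l::field ^ 'n ^ 'r \<Rightarrow> ('l ^ 'n) set \<Rightarrow> bool" where
  "generator_matrix G C \<longleftrightarrow>
     inj (\<lambda>i. row i G) \<and> vec.independent (rows G) \<and> vec.span (rows G) = C"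

text \<open>
  The row index type \<open>'r\<close> of the generator matrix is an explicit argument; a generator matrix
  \<open>G :: 'l ^ 'n ^ 'r\<close> of \<open>C\<close> can only exist if \<open>CARD('r)\<close> is the dimension of \<open>C\<close>. Injectivity
  of \<open>\<lambda>j. column j G\<close> makes the independence that of the columns as a family.
\<close>

definition nondegenerate ::
  "'r::finite itself \<Rightarrow> ('q::field \<Rightarrow> 'l::field) \<Rightarrow> ('l ^ 'n) set \<Rightarrow> bool" where
  "nondegenerate _ \<iota> C \<longleftrightarrow>
     (\<exists>G :: 'l ^ 'n ^ 'r. generator_matrix G C \<and>
        inj (\<lambda>j. column j G) \<and> \<not> module.dependent (scale_vec \<iota>) (columns G))"

definition associated_system ::
  "('q::field \<Rightarrow> 'l::field) \<Rightarrow> 'l ^ 'n ^ 'k \<Rightarrow> ('l ^ 'k) set" where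
  "associated_system \<iota> G = module.span (scale_vec \<iota>) (columns G)"

definition quasi_MRD :: "('q::field \<Rightarrow> 'l::field) \<Rightarrow> ('l ^ 'n) set \<Rightarrow> bool" where
  "quasi_MRD \<iota> C \<longleftrightarrow>
     (let m = ext_degree \<iota>; n = CARD('n); k = vec.dim C in
        vec.subspace C \<and> n > m \<and> \<not> n dvd m * k \<and>
        int (min_distance \<iota> C) = int m - \<lceil>real (k * m) / real n\<rceil> + 1)"

definition dually_quasi_MRD :: "('q::field \<Rightarrow> 'l::field) \<Rightarrow> ('l ^ 'n) set \<Rightarrow> bool" where
  "dually_quasi_MRD \<iota> C \<longleftrightarrow> quasi_MRD \<iota> C \<and> quasi_MRD \<iota> (dual_code C)"

definition eps_space ::
  "('q::field \<Rightarrow> 'l::field) \<Rightarrow> ('l ^ 'k) set \<Rightarrow> ('l ^ 'k) set \<Rightarrow> int" where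
  "eps_space \<iota> U T = int (subfield_dim \<iota> (U \<inter> T)) - int (vec.dim T)"

definition eps :: "('q::field \<Rightarrow> 'l::field) \<Rightarrow> ('l ^ 'k) set \<Rightarrow> nat \<Rightarrow> int" where
  "eps \<iota> U r = Max {eps_space \<iota> U T | T. vec.subspace T \<and> vec.dim T = r}"

definition scattered ::
  "('q::field \<Rightarrow> 'l::field) \<Rightarrow> nat \<Rightarrow> ('l ^ 'k) set \<Rightarrow> bool" where
  "scattered \<iota> h U \<longleftrightarrow>
     (\<forall>T. vec.subspace T \<and> vec.dim T = h \<longrightarrow> subfield_dim \<iota> (U \<inter> T) \<le> h)"

end

theory Submission
  imports Defs
begin

text \<open>
  The map \<open>a \<mapsto> G a\<close> from \<open>\<bbbF>\<^sub>q\<^sup>n\<close> onto \<open>U\<close> is a bijection because \<open>C\<close> is non-degenerate. Applied to the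
  functional \<open>a \<mapsto> x \<cdot> G a\<close>, rank-nullity says that the codeword \<open>x G\<close> has weight
  \<open>n - dim (U \<inter> x\<^sup>\<bottom>)\<close>, so that \<open>\<epsilon>(k - 1) = n - (k - 1) - d(C)\<close>; the quasi-MRD distance of \<open>C\<close> is \<open>m - k + 1\<close>.

  The quasi-MRD distance of the dual is \<open>k\<close>. A dual word of weight at most \<open>h\<close> is an
  \<open>\<bbbF>\<^bsub>q^m\<^esub>\<close>-linear relation between \<open>h\<close> elements of \<open>U\<close> that are independent over \<open>\<bbbF>\<^sub>q\<close>; for \<open>h = k - 1\<close>
  such a relation exists iff \<open>U\<close> is not \<open>(k - 2)\<close>-scattered. Conversely the dual always has a nonzero
  word of weight at most \<open>k\<close>: by counting it meets \<open>W\<^sup>n\<close>, where \<open>W\<close> is a \<open>k\<close>-dimensional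
  \<open>\<bbbF>\<^sub>q\<close>-subspace of \<open>\<bbbF>\<^bsub>q^m\<^esub>\<close>.
\<close>

section \<open>Linear algebra\<close>

text \<open>Extend a basis \<open>B\<close> of the kernel to a basis \<open>D\<close> of the whole
  space; \<open>f\<close> maps \<open>D - B\<close> injectively to a basis of its range. The
  codomain is left arbitrary because the lemma is applied to F_q-linear maps into F_{q^m} and
  F_{q^m}^k.\<close>

lemma (in finite_dimensional_vector_space_pair_1) dim_kernel_plus_dim_range:
  assumes f: "Vector_Spaces.linear s1 s2 f"
  shows "vs1.dim {x. f x = 0} + vs2.dim (range f) = vs1.dim UNIV"
proof -
  interpret f: Vector_Spaces.linear s1 s2 f by (rule f)
  let ?K = "{x. f x = 0}"
  obtain B where B: "B \<subseteq> ?K" "vs1.independent B" "?K \<subseteq> vs1.span B" "card B = vs1.dim ?K"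
    using vs1.basis_exists by blast
  obtain D where D: "B \<subseteq> D" "vs1.independent D" "UNIV \<subseteq> vs1.span D"
    using vs1.maximal_independent_subset_extend[of B UNIV] B(2) by auto
  have finD: "finite D" using D(2) by (rule vs1.finiteI_independent)
  have inj: "inj_on f (vs1.span (D - B))"
  proof (subst f.inj_on_iff_eq_0)
    show "vs1.subspace (vs1.span (D - B))" by simp
    show "\<forall>x\<in>vs1.span (D - B). f x = 0 \<longrightarrow> x = 0"
    proof (intro ballI impI)
      fix x assume x: "x \<in> vs1.span (D - B)" and "f x = 0"
      then have xB: "x \<in> vs1.span B" using B by auto
      have r1: "vs1.representation D x = vs1.representation (D - B) x"
        using vs1.representation_extend[OF D(2) x] by auto
      have r2: "vs1.representation D x = vs1.representation B x"
        using vs1.representation_extend[OF D(2) xB D(1)] by auto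
      \<comment> \<open>The coordinates of \<open>x\<close> with respect to \<open>D\<close> are
        supported both in \<open>B\<close> and in \<open>D - B\<close>, hence nowhere.\<close>
      have "vs1.representation D x b = 0" for b
        using vs1.representation_ne_zero[of B x b] vs1.representation_ne_zero[of "D - B" x b] r1 r2
        by (metis DiffD2)
      moreover have "(\<Sum>b | vs1.representation D x b \<noteq> 0. s1 (vs1.representation D x b) b) = x"
        using vs1.sum_nonzero_representation_eq[OF D(2)] D(3) by blast
      ultimately show "x = 0" by simp
    qed
  qed
  have ind: "vs2.independent (f ` (D - B))"
    using vs1.independent_mono[OF D(2) Diff_subset] inj by (rule f.independent_injective_image)
  have "range f = f ` vs1.span D" using D(3) by auto
  also have "\<dots> = vs2.span (f ` D)" by (simp add: f.span_image)
  also have "\<dots> \<subseteq> vs2.span (f ` (D - B))"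
  proof (rule vs2.span_minimal)
    show "f ` D \<subseteq> vs2.span (f ` (D - B))"
    proof (rule image_subsetI)
      fix d assume "d \<in> D"
      show "f d \<in> vs2.span (f ` (D - B))"
      proof (cases "d \<in> B")
        case True
        then have "f d = 0" using B by auto
        then show ?thesis by (simp add: vs2.span_zero)
      next
        case False
        then show ?thesis using \<open>d \<in> D\<close> by (auto intro: vs2.span_base)
      qed
    qed
  qed simp
  finally have sp: "range f \<subseteq> vs2.span (f ` (D - B))" .
  have "card (f ` (D - B)) = vs2.dim (range f)"
    by (rule vs2.basis_card_eq_dim[OF _ sp ind]) auto
  moreover have "card (f ` (D - B)) = card (D - B)"
    by (rule card_image[OF inj_on_subset[OF inj vs1.span_superset]])
  moreover have "card D = vs1.dim UNIV"
    using D by (intro vs1.basis_card_eq_dim) auto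
  moreover have "card (D - B) = card D - card B" "card B \<le> card D"
    using finD D(1) by (auto intro: card_Diff_subset card_mono finite_subset)
  ultimately show ?thesis using B(4) by simp
qed

text \<open>Taking coordinates is a bijection from the span to the coefficient families on
  \<open>B\<close>; these are taken extensional so that distinct ones differ on
  \<open>B\<close>.\<close>

lemma card_span_independent:
  fixes scale :: "'a::{field,finite} \<Rightarrow> 'b::ab_group_add \<Rightarrow> 'b"
  assumes vs: "vector_space scale" and fin: "finite B"
    and ind: "\<not> module.dependent scale B"
  shows "card (module.span scale B) = CARD('a) ^ card B"
proof -
  interpret vector_space scale by (rule vs)
  let ?f = "\<lambda>u. \<Sum>b\<in>B. scale (u b) b"
  have "inj_on ?f (B \<rightarrow>\<^sub>E UNIV)"
  proof (rule inj_onI)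
    fix u w assume uw: "u \<in> B \<rightarrow>\<^sub>E UNIV" "w \<in> B \<rightarrow>\<^sub>E UNIV" and "?f u = ?f w"
    then have "(\<Sum>b\<in>B. scale (u b - w b) b) = 0"
      by (simp add: scale_left_diff_distrib sum_subtractf)
    then have "u b - w b = 0" if "b \<in> B" for b
      using independentD[OF ind fin subset_refl _ that, of "\<lambda>b. u b - w b"] by blast
    then show "u = w" using uw by (intro PiE_ext) auto
  qed
  moreover have "?f ` (B \<rightarrow>\<^sub>E UNIV) = span B"
  proof -
    have "?f u \<in> ?f ` (B \<rightarrow>\<^sub>E UNIV)" for u
      by (rule image_eqI[where x = "restrict u B"]) auto
    then show ?thesis using span_finite[OF fin] by auto
  qed
  ultimately show ?thesis
    using card_image[of ?f "B \<rightarrow>\<^sub>E UNIV"] by (simp add: card_PiE fin)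
qed

lemma card_vec_restricted:
  "card {v :: 'a::finite ^ 'n::finite. \<forall>i. v $ i \<in> W} = card W ^ CARD('n)"
proof -
  have "bij_betw vec_nth {v :: 'a ^ 'n. \<forall>i. v $ i \<in> W} (UNIV \<rightarrow>\<^sub>E W)"
    by (rule bij_betw_byWitness[where f' = vec_lambda])
      (auto simp: PiE_def Pi_def vec_lambda_inverse)
  then have "card {v :: 'a ^ 'n. \<forall>i. v $ i \<in> W} = card ((UNIV :: 'n set) \<rightarrow>\<^sub>E W)"
    by (rule bij_betw_same_card)
  then show ?thesis by (simp add: card_PiE)
qed

text \<open>Adjointness of \<open>G\<close>: it converts statements about codewords
  \<open>x v* G\<close> into statements about vectors \<open>G *v y\<close> and the hyperplane
  orthogonal to \<open>x\<close>.\<close>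

lemma scalar_product_vector_matrix:
  fixes G :: "'a::comm_semiring_1 ^ 'n ^ 'k"
  shows "scalar_product (x v* G) y = scalar_product x (G *v y)"
proof -
  have "scalar_product (x v* G) y = (\<Sum>j\<in>UNIV. \<Sum>i\<in>UNIV. x $ i * G $ i $ j * y $ j)"
    by (simp add: scalar_product_def vector_matrix_mult_def sum_distrib_right)
  also have "\<dots> = (\<Sum>i\<in>UNIV. \<Sum>j\<in>UNIV. x $ i * G $ i $ j * y $ j)"
    by (rule sum.swap)
  also have "\<dots> = scalar_product x (G *v y)"
    by (simp add: scalar_product_def matrix_vector_mult_def sum_distrib_left mult.assoc)
  finally show ?thesis .
qed

lemma scalar_product_axis:
  "scalar_product x (axis i 1) = x $ i"
  by (simp add: scalar_product_def axis_def if_distrib cong: if_cong)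

lemma linear_scalar_product:
  "Vector_Spaces.linear (*s) (*) (scalar_product (x :: 'a::field ^ 'n))"
  by unfold_locales
    (auto simp: scalar_product_def algebra_simps sum.distrib sum_distrib_left)

lemma dim_orthogonal_hyperplane:
  fixes x :: "'a::field ^ 'k"
  assumes "x \<noteq> 0"
  shows "vec.dim {y. scalar_product x y = 0} = CARD('k) - 1"
proof -
  interpret p: finite_dimensional_vector_space_pair_1
    "(*s) :: 'a \<Rightarrow> 'a ^ 'k \<Rightarrow> _" cart_basis "(*) :: 'a \<Rightarrow> 'a \<Rightarrow> 'a" by unfold_locales
  obtain i where i: "x $ i \<noteq> 0" using assms by (auto simp: vec_eq_iff)
  have "range (scalar_product x) = UNIV"
  proof (rule surjI)
    fix a show "scalar_product x (axis i (a / x $ i)) = a"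
      using i by (simp add: scalar_product_def axis_def if_distrib cong: if_cong)
  qed
  then show ?thesis
    using p.dim_kernel_plus_dim_range[OF linear_scalar_product[of x]]
    by (simp add: vec_dim_card del: vec.dim_UNIV)
qed

text \<open>Take the functional that vanishes on a basis of \<open>T\<close> and is 1 at some
  \<open>e\<close> outside \<open>T\<close>. Its values on the standard basis form \<open>x\<close>,
  and equality of dimensions identifies its kernel with \<open>T\<close>.\<close>

lemma hyperplane_eq_orthogonal:
  fixes T :: "('a::field ^ 'k) set"
  assumes T: "vec.subspace T" and d: "vec.dim T = CARD('k) - 1"
  obtains x where "x \<noteq> 0" "T = {y. scalar_product x y = 0}"
proof -
  interpret p: vector_space_pair
    "(*s) :: 'a \<Rightarrow> 'a ^ 'k \<Rightarrow> _" "(*) :: 'a \<Rightarrow> 'a \<Rightarrow> 'a" by unfold_locales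
  obtain B where B: "B \<subseteq> T" "vec.independent B" "T \<subseteq> vec.span B" "card B = vec.dim T"
    using vec.basis_exists by blast
  \<comment> \<open>Index types are nonempty, so the subtraction in the hypothesis does not truncate
    and \<open>T\<close> is proper.\<close>
  have "vec.dim T \<noteq> CARD('k)"
    using d zero_less_card_finite[where 'a='k] by linarith
  then have "T \<noteq> UNIV" using vec_dim_card by metis
  then obtain e where e: "e \<notin> T" by blast
  have spB: "vec.span B = T" using B T by (simp add: vec.span_subspace)
  then have ind: "vec.independent (insert e B)" using e B by (simp add: vec.independent_insertI)
  obtain g where g: "Vector_Spaces.linear (*s) (*) g"
    "\<And>b. b \<in> insert e B \<Longrightarrow> g b = (if b = e then 1 else 0)"
    using p.linear_independent_extend[OF ind, of "\<lambda>b. if b = e then 1 else 0"] by blast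
  interpret g: Vector_Spaces.linear "(*s)" "(*)" g by (rule g(1))
  define x where "x = (\<chi> i. g (axis i 1))"
  have gx: "g y = scalar_product x y" for y
  proof -
    have "g y = g (\<Sum>i\<in>UNIV. y $ i *s axis i 1)" by (simp add: basis_expansion)
    also have "\<dots> = (\<Sum>i\<in>UNIV. y $ i * g (axis i 1))" by (simp add: g.sum g.scale)
    finally show ?thesis by (simp add: x_def scalar_product_def mult.commute)
  qed
  have "g e = 1" using g(2)[of e] by simp
  then have x0: "x \<noteq> 0" using gx[of e] by (auto simp: scalar_product_def)
  have "g y = 0" if "y \<in> T" for y
  proof (rule g.eq_0_on_span)
    show "y \<in> vec.span B" using that spB by simp
    show "g b = 0" if "b \<in> B" for b
      using that g(2)[of b] e B by auto
  qed
  then have sub: "T \<subseteq> {y. scalar_product x y = 0}" using gx by auto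
  have "T = {y. scalar_product x y = 0}"
  proof (rule vec.subspace_dim_equal[OF T _ sub])
    show "vec.subspace {y. scalar_product x y = 0}"
      using g.subspace_kernel by (simp add: gx)
    show "vec.dim {y. scalar_product x y = 0} \<le> vec.dim T"
      using dim_orthogonal_hyperplane[OF x0] d by simp
  qed
  with x0 show thesis by (rule that)
qed

text \<open>Cut a set of size \<open>d\<close> out between a basis of \<open>S\<close> and a basis
  of the whole space containing it. This serves scatteredness, which tests subspaces of one exact
  dimension.\<close>

lemma vec_subspace_extend_dim:
  fixes S :: "('a::field ^ 'k) set"
  assumes "vec.dim S \<le> d" "d \<le> CARD('k)"
  obtains T where "vec.subspace T" "S \<subseteq> T" "vec.dim T = d"
proof -
  obtain B where B: "B \<subseteq> S" "vec.independent B" "S \<subseteq> vec.span B" "card B = vec.dim S"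
    using vec.basis_exists by blast
  obtain D where D: "B \<subseteq> D" "vec.independent D" "UNIV \<subseteq> vec.span D"
    using vec.maximal_independent_subset_extend[of B UNIV] B(2) by auto
  have "card D = CARD('k)"
    using D by (metis vec.basis_card_eq_dim subset_UNIV vec_dim_card)
  then obtain E where E: "B \<subseteq> E" "E \<subseteq> D" "card E = d"
    using exists_subset_between[of B d D] B(4) assms D vec.finiteI_independent by metis
  have "vec.independent E" using E D vec.independent_mono by blast
  then have "vec.dim (vec.span E) = d" using E by (metis vec.dim_span_eq_card_independent)
  moreover have "S \<subseteq> vec.span E" using B(3) vec.span_mono[OF E(1)] by blast
  ultimately show thesis by (intro that[of "vec.span E"]) auto
qed

section \<open>Generator matrices and dual codes\<close>

lemma matrix_vector_mult_axis:
  fixes A :: "'a::semiring_1 ^ 'n ^ 'm"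
  shows "A *v axis j 1 = column j A"
  by (simp add: vec_eq_iff matrix_vector_mult_def column_def axis_def if_distrib cong: if_cong)

lemma columns_eq_image_cart_basis:
  fixes A :: "'a::semiring_1 ^ 'n ^ 'm"
  shows "columns A = (*v) A ` cart_basis"
  by (force simp: columns_def cart_basis_def matrix_vector_mult_axis)

lemma generator_matrix_surj:
  fixes G :: "'a::field ^ 'n ^ 'k"
  assumes "generator_matrix G C"
  shows "surj ((*v) G)"
proof -
  have "\<exists>B. G ** B = mat 1"
  proof (subst matrix_right_invertible_independent_rows, intro allI impI)
    fix c i assume 0: "(\<Sum>i\<in>UNIV. c i *s row i G) = 0"
    have inj: "inj (\<lambda>i. row i G)" and ind: "vec.independent (rows G)"
      using assms by (auto simp: generator_matrix_def)
    have rows: "rows G = range (\<lambda>i. row i G)" by (auto simp: rows_def)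
    \<comment> \<open>The relation is indexed by \<open>i\<close>, while independence concerns the
      set of rows; injectivity of the row map translates the coefficients.\<close>
    let ?u = "\<lambda>v. c (inv (\<lambda>i. row i G) v)"
    have "(\<Sum>v\<in>rows G. ?u v *s v) = 0"
      unfolding rows using 0 by (subst sum.reindex[OF inj]) (simp add: inv_f_f[OF inj])
    from vec.independentD[OF ind _ subset_refl this, of "row i G"]
    show "c i = 0" by (simp add: rows inv_f_f[OF inj])
  qed
  then show ?thesis by (simp add: matrix_right_invertible_surjective)
qed

lemma generator_matrix_range:
  fixes G :: "'a::field ^ 'n ^ 'k"
  assumes "generator_matrix G C"
  shows "C = range (\<lambda>x. x v* G)"
proof -
  have eq: "(\<lambda>x. x v* G) = (*v) (transpose G)" by (rule ext) simp
  have img: "(*v) (transpose G) ` cart_basis = rows G"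
    by (simp only: columns_eq_image_cart_basis[symmetric] columns_transpose)
  have "range ((*v) (transpose G)) = (*v) (transpose G) ` vec.span cart_basis"
    by simp
  also have "\<dots> = vec.span (rows G)"
    by (simp only: vec.linear_span_image[OF matrix_vector_mul_linear_gen, symmetric] img)
  finally show ?thesis using assms eq by (simp add: generator_matrix_def)
qed

text \<open>Dual to surjectivity: if \<open>axis i 1 = G *v y\<close>, then \<open>x $ i\<close> is
  the product of \<open>x v* G\<close> with \<open>y\<close>.\<close>

lemma generator_matrix_inj:
  fixes G :: "'a::field ^ 'n ^ 'k"
  assumes "generator_matrix G C" and x: "x v* G = 0"
  shows "x = 0"
proof -
  have "x $ i = 0" for i
  proof -
    obtain y where "axis i 1 = G *v y" using generator_matrix_surj[OF assms(1)] by (metis surjD)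
    then have "x $ i = scalar_product (x v* G) y"
      by (metis scalar_product_axis scalar_product_vector_matrix)
    then show ?thesis using x by (simp add: scalar_product_def)
  qed
  then show ?thesis by (simp add: vec_eq_iff)
qed

text \<open>By adjointness \<open>v\<close> is orthogonal to all codewords iff \<open>G *v v\<close>
  is orthogonal to every \<open>x\<close>. In particular all generator matrices of \<open>C\<close>
  have the same kernel.\<close>

lemma dual_code_kernel:
  fixes G :: "'a::field ^ 'n ^ 'k"
  assumes "generator_matrix G C"
  shows "dual_code C = {v. G *v v = 0}"
proof (intro set_eqI)
  fix v
  have comm: "scalar_product v c = scalar_product c v" for c :: "'a ^ 'n"
    by (simp add: scalar_product_def mult.commute)
  have "v \<in> dual_code C \<longleftrightarrow> (\<forall>x. scalar_product x (G *v v) = 0)"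
    unfolding generator_matrix_range[OF assms]
    by (auto simp: dual_code_def comm scalar_product_vector_matrix)
  also have "\<dots> \<longleftrightarrow> G *v v = 0"
  proof
    assume h: "\<forall>x. scalar_product x (G *v v) = 0"
    have "(G *v v) $ i = scalar_product (axis i 1) (G *v v)" for i
      by (simp add: scalar_product_def axis_def if_distrib if_distribR cong: if_cong)
    then show "G *v v = 0" using h by (simp add: vec_eq_iff)
  qed (simp add: scalar_product_def)
  finally show "v \<in> dual_code C \<longleftrightarrow> v \<in> {v. G *v v = 0}" by simp
qed

lemma dim_dual_code:
  fixes G :: "'a::field ^ 'n ^ 'k"
  assumes "generator_matrix G C"
  shows "vec.dim (dual_code C) + CARD('k) = CARD('n)"
  using vec.dim_kernel_plus_dim_range[OF matrix_vector_mul_linear_gen[of G]]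
    generator_matrix_surj[OF assms]
  by (simp add: dual_code_kernel[OF assms] vec_dim_card del: vec.dim_UNIV)

lemma subspace_dual_code: "vec.subspace (dual_code C)"
  by (rule vec.subspaceI)
    (auto simp: dual_code_def scalar_product_def algebra_simps sum.distrib
      simp flip: sum_distrib_left)


lemma min_distance_subspace:
  fixes C :: "('l::{field,finite} ^ 'n) set"
  assumes C: "vec.subspace C"
  shows "min_distance \<iota> C = Min (rank_weight \<iota> ` (C - {0}))"
proof -
  have "{rank_weight \<iota> (x - y) | x y. x \<in> C \<and> y \<in> C \<and> x \<noteq> y} = rank_weight \<iota> ` (C - {0})"
    (is "?L = ?R")
  proof
    show "?L \<subseteq> ?R" using vec.subspace_diff[OF C] by auto
    have "rank_weight \<iota> (v - 0) \<in> ?L" if "v \<in> C - {0}" for v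
      using that vec.subspace_0[OF C] by blast
    then show "?R \<subseteq> ?L" by auto
  qed
  then show ?thesis by (simp add: min_distance_def)
qed

section \<open>Vectors over the subfield\<close>

text \<open>With this embedding F_q^n remains a coordinate space in its own right, and
  F_q-dimensions in F_{q^m}^k can be computed by pulling back to it.\<close>

definition subfield_vec :: "('q \<Rightarrow> 'l) \<Rightarrow> 'q ^ 'n \<Rightarrow> 'l ^ 'n" where
  "subfield_vec \<iota> a = (\<chi> i. \<iota> (a $ i))"

locale finite_field_extension =
  fixes \<iota> :: "'q::{field,finite} \<Rightarrow> 'l::{field,finite}"
  assumes embedding: "field_embedding \<iota>"
begin

lemma embedding_simps [simp]:
  "\<iota> 0 = 0" "\<iota> 1 = 1" "\<iota> (x + y) = \<iota> x + \<iota> y" "\<iota> (x * y) = \<iota> x * \<iota> y"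
proof -
  show add: "\<iota> (x + y) = \<iota> x + \<iota> y" for x y using embedding by (simp add: field_embedding_def)
  show "\<iota> 0 = 0" using add[of 0 0] by (metis add.right_neutral add_cancel_right_left)
qed (use embedding in \<open>auto simp: field_embedding_def\<close>)

lemma embedding_eq_0_iff [simp]: "\<iota> x = 0 \<longleftrightarrow> x = 0"
  by (metis embedding_simps(1,2,4) mult_zero_left right_inverse zero_neq_one)

lemma subfield_vec_nth [simp]: "subfield_vec \<iota> a $ i = \<iota> (a $ i)"
  by (simp add: subfield_vec_def)

lemma subfield_vec_simps [simp]:
  "subfield_vec \<iota> 0 = 0" "subfield_vec \<iota> (a + b) = subfield_vec \<iota> a + subfield_vec \<iota> b"
  "subfield_vec \<iota> (c *s a) = \<iota> c *s subfield_vec \<iota> a"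
  "subfield_vec \<iota> (axis i 1) = axis i 1"
  by (auto simp: vec_eq_iff axis_def)

sublocale elem: vector_space "scale_elem \<iota>"
  by (rule vector_space_scale_elem[OF embedding])

lemma linear_subfield_product:
  "Vector_Spaces.linear (*s) (scale_elem \<iota>) (\<lambda>a. scalar_product (subfield_vec \<iota> a) v)"
  by unfold_locales
    (auto simp: scalar_product_def algebra_simps sum.distrib scale_elem_def sum_distrib_left)

lemma linear_column_combination:
  "Vector_Spaces.linear (*s) (scale_vec \<iota>) (\<lambda>a. G *v subfield_vec \<iota> a)"
proof -
  interpret vq: vector_space "scale_vec \<iota>" by (rule vector_space_scale_vec[OF embedding])
  show ?thesis
    by unfold_locales
      (auto simp: matrix_vector_right_distrib scale_vec_def vector_scalar_commute)
qed

text \<open>Rank-nullity for the map sending \<open>a\<close> to the sum of the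
  \<open>a_i v_i\<close>, whose image is the F_q-span of the entries of \<open>v\<close>.\<close>

lemma dim_kernel_plus_rank_weight:
  fixes v :: "'l ^ 'n"
  shows "vec.dim {a :: 'q ^ 'n. scalar_product (subfield_vec \<iota> a) v = 0} + rank_weight \<iota> v = CARD('n)"
proof -
  interpret p: finite_dimensional_vector_space_pair_1
    "(*s) :: 'q \<Rightarrow> 'q ^ 'n \<Rightarrow> _" cart_basis "scale_elem \<iota>" by unfold_locales
  let ?f = "\<lambda>a :: 'q ^ 'n. scalar_product (subfield_vec \<iota> a) v"
  have "?f (axis i 1) = v $ i" for i
    by (simp add: scalar_product_def axis_def if_distrib if_distribR cong: if_cong)
  then have "?f ` cart_basis = range (\<lambda>i. v $ i)"
    by (auto simp: cart_basis_def image_iff simp del: subfield_vec_simps(4)) metis+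
  then have "elem.span (range (\<lambda>i. v $ i)) = ?f ` vec.span cart_basis"
    using p.linear_span_image[OF linear_subfield_product, of v cart_basis] by simp
  then have "rank_weight \<iota> v = elem.dim (range ?f)"
    by (simp add: rank_weight_def)
  then show ?thesis
    using p.dim_kernel_plus_dim_range[OF linear_subfield_product[of v]]
    by (simp add: vec_dim_card del: vec.dim_UNIV)
qed

lemma associated_system_range:
  fixes G :: "'l ^ 'n ^ 'k"
  shows "associated_system \<iota> G = range (\<lambda>a. G *v subfield_vec \<iota> a)"
proof -
  interpret vq: vector_space "scale_vec \<iota> :: 'q \<Rightarrow> 'l ^ 'k \<Rightarrow> _"
    by (rule vector_space_scale_vec[OF embedding])
  interpret p: vector_space_pair "(*s) :: 'q \<Rightarrow> 'q ^ 'n \<Rightarrow> _" "scale_vec \<iota> :: 'q \<Rightarrow> 'l ^ 'k \<Rightarrow> _"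
    by unfold_locales
  let ?f = "\<lambda>a. G *v subfield_vec \<iota> a"
  have "?f ` cart_basis = columns G"
    by (force simp: cart_basis_def columns_def matrix_vector_mult_axis)
  then have "associated_system \<iota> G = ?f ` vec.span cart_basis"
    using p.linear_span_image[OF linear_column_combination, of G cart_basis]
    by (simp add: associated_system_def)
  then show ?thesis by simp
qed

text \<open>Non-degeneracy only supplies some generator matrix \<open>H\<close>, possibly not
  \<open>G\<close>. A dimension count gives trivial kernel on F_q^n for \<open>H\<close>; it passes
  to \<open>G\<close> because both matrices have the dual code as kernel.\<close>

lemma nondegenerate_imp_inj:
  fixes G :: "'l ^ 'n ^ 'k" and C :: "('l ^ 'n) set"
  assumes nd: "nondegenerate TYPE('r::finite) \<iota> C" and G: "generator_matrix G C"
  shows "inj (\<lambda>a. G *v subfield_vec \<iota> a)"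
proof -
  obtain H :: "'l ^ 'n ^ 'r" where H: "generator_matrix H C" "inj (\<lambda>j. column j H)"
    and ind: "\<not> module.dependent (scale_vec \<iota>) (columns H)"
    using nd by (auto simp: nondegenerate_def)
  interpret vq: vector_space "scale_vec \<iota> :: 'q \<Rightarrow> 'l ^ 'r \<Rightarrow> _"
    by (rule vector_space_scale_vec[OF embedding])
  interpret p: finite_dimensional_vector_space_pair_1
    "(*s) :: 'q \<Rightarrow> 'q ^ 'n \<Rightarrow> _" cart_basis "scale_vec \<iota> :: 'q \<Rightarrow> 'l ^ 'r \<Rightarrow> _"
    by unfold_locales
  have "columns H = range (\<lambda>j. column j H)" by (auto simp: columns_def)
  then have "card (columns H) = CARD('n)" using H(2) by (simp add: card_image)
  then have "vq.dim (range (\<lambda>a. H *v subfield_vec \<iota> a)) = CARD('n)"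
    using associated_system_range[of H] vq.dim_span_eq_card_independent[OF ind]
    by (simp add: associated_system_def)
  then have "vec.dim {a. H *v subfield_vec \<iota> a = 0} = 0"
    using p.dim_kernel_plus_dim_range[OF linear_column_combination[of H]]
    by (simp add: vec_dim_card del: vec.dim_UNIV)
  then have *: "{a. H *v subfield_vec \<iota> a = 0} \<subseteq> {0}" by (simp only: vec.dim_eq_0)
  have "a = 0" if "G *v subfield_vec \<iota> a = 0" for a
  proof -
    have "subfield_vec \<iota> a \<in> dual_code C" using that by (simp add: dual_code_kernel[OF G])
    then have "H *v subfield_vec \<iota> a = 0" by (simp add: dual_code_kernel[OF H(1)])
    then show ?thesis using * by auto
  qed
  then show ?thesis
    using module_hom.inj_iff_eq_0[OF Vector_Spaces.linear.axioms(3)[OF linear_column_combination[of G]]]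
    by blast
qed

lemma subfield_dim_associated_system_Int:
  fixes G :: "'l ^ 'n ^ 'k"
  assumes "inj (\<lambda>a. G *v subfield_vec \<iota> a)" "vec.subspace T"
  shows "subfield_dim \<iota> (associated_system \<iota> G \<inter> T) = vec.dim {a. G *v subfield_vec \<iota> a \<in> T}"
proof -
  interpret vq: vector_space "scale_vec \<iota> :: 'q \<Rightarrow> 'l ^ 'k \<Rightarrow> _"
    by (rule vector_space_scale_vec[OF embedding])
  interpret p: finite_dimensional_vector_space_pair_1
    "(*s) :: 'q \<Rightarrow> 'q ^ 'n \<Rightarrow> _" cart_basis "scale_vec \<iota> :: 'q \<Rightarrow> 'l ^ 'k \<Rightarrow> _"
    by unfold_locales
  have "associated_system \<iota> G \<inter> T = (\<lambda>a. G *v subfield_vec \<iota> a) ` {a. G *v subfield_vec \<iota> a \<in> T}"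
    by (auto simp: associated_system_range)
  then show ?thesis
    using p.dim_image_eq[OF linear_column_combination inj_on_subset[OF assms(1) subset_UNIV]]
    by simp
qed

lemma subfield_vec_span:
  assumes "a \<in> vec.span B"
  shows "subfield_vec \<iota> a \<in> vec.span (subfield_vec \<iota> ` B)"
  using assms
  by (induction rule: vec.span_induct_alt)
    (auto intro: vec.span_zero vec.span_add vec.span_scale vec.span_base)

lemma inj_subfield_vec: "inj (subfield_vec \<iota>)"
proof (rule injI)
  fix a b :: "'q ^ 'n" assume "subfield_vec \<iota> a = subfield_vec \<iota> b"
  moreover have "subfield_vec \<iota> (a - b) + subfield_vec \<iota> b = subfield_vec \<iota> a"
    using subfield_vec_simps(2)[of "a - b" b] by simp
  ultimately have "subfield_vec \<iota> (a - b) = 0" by simp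
  then show "a = b" by (simp add: vec_eq_iff)
qed

text \<open>Independence survives the extension of scalars: a basis of F_q^n containing
  \<open>B\<close> still spans the standard basis over F_{q^m}, and \<open>n\<close> spanning
  vectors are independent.\<close>

lemma independent_subfield_vec:
  fixes B :: "('q ^ 'n) set"
  assumes "vec.independent B"
  shows "vec.independent (subfield_vec \<iota> ` B)"
proof -
  obtain D where D: "B \<subseteq> D" "vec.independent D" "UNIV \<subseteq> vec.span D"
    using vec.maximal_independent_subset_extend[of B UNIV] assms by auto
  have cD: "card D = CARD('n)"
    using D by (metis vec.basis_card_eq_dim subset_UNIV vec_dim_card)
  have "(cart_basis :: ('l ^ 'n) set) \<subseteq> vec.span (subfield_vec \<iota> ` D)"
  proof
    fix x :: "'l ^ 'n" assume "x \<in> cart_basis"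
    then obtain i where "x = subfield_vec \<iota> (axis i 1)" by (auto simp: cart_basis_def)
    then show "x \<in> vec.span (subfield_vec \<iota> ` D)" using D(3) subfield_vec_span by blast
  qed
  then have "vec.span (cart_basis :: ('l ^ 'n) set) \<subseteq> vec.span (subfield_vec \<iota> ` D)"
    by (rule vec.span_minimal) simp
  then have "vec.independent (subfield_vec \<iota> ` D)"
    using cD by (intro vec.card_le_dim_spanning[of _ UNIV])
      (auto simp: vec_dim_card card_image inj_on_subset[OF inj_subfield_vec] simp del: vec.dim_UNIV)
  then show ?thesis using D(1) vec.independent_mono by blast
qed

text \<open>The vectors in \<open>B\<close> have entries in F_q, so every entry of \<open>v\<close>
  is an F_q-combination of the at most \<open>card B\<close> coefficients that express
  \<open>v\<close>.\<close>

lemma rank_weight_le_card: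
  fixes v :: "'l ^ 'n"
  assumes "v \<in> vec.span (subfield_vec \<iota> ` B)"
  shows "rank_weight \<iota> v \<le> card B"
proof -
  let ?W = "subfield_vec \<iota> ` B"
  have fin: "finite ?W" by simp
  obtain u where u: "v = (\<Sum>w\<in>?W. u w *s w)"
    using assms vec.span_finite[OF fin] by auto
  have "v $ i \<in> elem.span (u ` ?W)" for i
  proof -
    have "v $ i = (\<Sum>w\<in>?W. u w * w $ i)" by (simp add: u)
    also have "\<dots> \<in> elem.span (u ` ?W)"
    proof (rule elem.span_sum)
      fix w assume w: "w \<in> ?W"
      then obtain b where "w = subfield_vec \<iota> b" by blast
      then have "u w * w $ i = scale_elem \<iota> (b $ i) (u w)" by (simp add: scale_elem_def)
      then show "u w * w $ i \<in> elem.span (u ` ?W)"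
        using w by (auto intro: elem.span_scale elem.span_base)
    qed
    finally show ?thesis .
  qed
  then have "elem.dim (range (\<lambda>i. v $ i)) \<le> card (u ` ?W)"
    by (intro elem.dim_le_card) auto
  also have "\<dots> \<le> card B" by (meson card_image_le finite le_trans)
  finally show ?thesis by (simp add: rank_weight_def)
qed

text \<open>Expand the entries of \<open>v\<close> in an F_q-basis \<open>A\<close> of their span
  and collect the coordinates belonging to each \<open>a\<close> into a vector \<open>l a\<close>
  over F_q; then \<open>v\<close> is the sum of the
  \<open>a *s subfield_vec \<iota> (l a)\<close>.\<close>

lemma rank_weight_support:
  fixes v :: "'l ^ 'n"
  obtains B where "vec.independent B" "card B \<le> rank_weight \<iota> v"
    "v \<in> vec.span (subfield_vec \<iota> ` B)"
proof -
  obtain A where A: "elem.independent A" "range (\<lambda>i. v $ i) \<subseteq> elem.span A"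
      "card A = elem.dim (range (\<lambda>i. v $ i))"
    using elem.basis_exists by blast
  have "\<exists>u. v $ i = (\<Sum>a\<in>A. \<iota> (u a) * a)" for i
    using A(2) elem.span_finite[of A] by (auto simp: scale_elem_def)
  then obtain c where c: "\<And>i. v $ i = (\<Sum>a\<in>A. \<iota> (c i a) * a)" by metis
  define l where "l a = (\<chi> i. c i a)" for a
  have v: "v = (\<Sum>a\<in>A. a *s subfield_vec \<iota> (l a))"
    by (simp add: vec_eq_iff c l_def mult.commute)
  obtain B where B: "B \<subseteq> l ` A" "vec.independent B" "l ` A \<subseteq> vec.span B"
    using vec.maximal_independent_subset by blast
  have "v \<in> vec.span (subfield_vec \<iota> ` B)"
    unfolding v using B(3)
    by (intro vec.span_sum vec.span_scale subfield_vec_span) auto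
  moreover have "card B \<le> rank_weight \<iota> v"
    using card_mono[OF _ B(1)] card_image_le[of A l] A(3)
    by (simp add: rank_weight_def)
  ultimately show thesis using that B(2) by blast
qed

section \<open>Weights and the associated system\<close>

text \<open>Words of weight at most \<open>h\<close> are the F_{q^m}-combinations of
  \<open>h\<close> independent vectors over F_q. A nonzero one in the kernel of \<open>G\<close>
  exists on such a span exactly when the images of these vectors are dependent.\<close>

lemma low_weight_dual_word_iff:
  fixes G :: "'l ^ 'n ^ 'k"
  assumes inj: "inj (\<lambda>a. G *v subfield_vec \<iota> a)" and h: "h \<le> CARD('n)"
  shows "(\<exists>v. G *v v = 0 \<and> v \<noteq> 0 \<and> rank_weight \<iota> v \<le> h) \<longleftrightarrow>
    (\<exists>B. vec.independent B \<and> card B = h \<and> vec.dependent ((\<lambda>a. G *v subfield_vec \<iota> a) ` B))"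
proof
  assume "\<exists>v. G *v v = 0 \<and> v \<noteq> 0 \<and> rank_weight \<iota> v \<le> h"
  then obtain v where v: "G *v v = 0" "v \<noteq> 0" "rank_weight \<iota> v \<le> h" by blast
  obtain B where B: "vec.independent B" "card B \<le> rank_weight \<iota> v"
    "v \<in> vec.span (subfield_vec \<iota> ` B)" by (rule rank_weight_support)
  obtain D where D: "B \<subseteq> D" "vec.independent D" "UNIV \<subseteq> vec.span D"
    using vec.maximal_independent_subset_extend[of B UNIV] B(1) by auto
  have "card D = CARD('n)"
    using D by (metis vec.basis_card_eq_dim subset_UNIV vec_dim_card)
  \<comment> \<open>The support may have fewer than \<open>h\<close> elements; it is padded to
    exactly \<open>h\<close>, which \<open>h \<le> CARD('n)\<close> permits.\<close>
  then obtain E where E: "B \<subseteq> E" "E \<subseteq> D" "card E = h"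
    using exists_subset_between[of B h D] B(2) v(3) h D(1) by auto
  have vE: "v \<in> vec.span (subfield_vec \<iota> ` E)"
    using B(3) vec.span_mono[OF image_mono[OF E(1)]] by blast
  have "vec.dependent ((*v) G ` subfield_vec \<iota> ` E)"
  proof (rule ccontr)
    assume "vec.independent ((*v) G ` subfield_vec \<iota> ` E)"
    moreover have "inj_on ((*v) G) (subfield_vec \<iota> ` E)"
      using inj by (auto simp: inj_on_def)
    ultimately have "inj_on ((*v) G) (vec.span (subfield_vec \<iota> ` E))"
      by (rule vec.inj_on_span_independent_image)
    then have "v = 0" using vE v(1) vec.span_zero by (metis inj_onD matrix_vector_mult_0_right)
    then show False using v(2) by simp
  qed
  then show "\<exists>B. vec.independent B \<and> card B = h \<and>
      vec.dependent ((\<lambda>a. G *v subfield_vec \<iota> a) ` B)"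
    using E vec.independent_mono[OF D(2) E(2)] by (auto simp: image_image)
next
  assume "\<exists>B. vec.independent B \<and> card B = h \<and> vec.dependent ((\<lambda>a. G *v subfield_vec \<iota> a) ` B)"
  then obtain B where B: "vec.independent B" "card B = h"
    "vec.dependent ((*v) G ` subfield_vec \<iota> ` B)" by (auto simp: image_image)
  have "\<not> inj_on ((*v) G) (vec.span (subfield_vec \<iota> ` B))"
    using vec.independent_injective_image[OF independent_subfield_vec[OF B(1)]] B(3) by blast
  then obtain v where "v \<in> vec.span (subfield_vec \<iota> ` B)" "G *v v = 0" "v \<noteq> 0"
    using vec.inj_on_iff_eq_0[of "vec.span (subfield_vec \<iota> ` B)" G] by auto
  then show "\<exists>v. G *v v = 0 \<and> v \<noteq> 0 \<and> rank_weight \<iota> v \<le> h"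
    using rank_weight_le_card[of v B] B(2) by auto
qed

text \<open>If \<open>U\<close> meets an \<open>h\<close>-dimensional \<open>T\<close> in more than
  \<open>h\<close> dimensions over F_q, then \<open>h + 1\<close> F_q-independent elements of the
  intersection are too many to be independent over F_{q^m}. Conversely, \<open>h + 1\<close>
  dependent images span at most \<open>h\<close> dimensions and fit into some
  \<open>T\<close>.\<close>

lemma not_scattered_iff:
  fixes G :: "'l ^ 'n ^ 'k"
  assumes inj: "inj (\<lambda>a. G *v subfield_vec \<iota> a)" and h: "h \<le> CARD('k)"
  shows "\<not> scattered \<iota> h (associated_system \<iota> G) \<longleftrightarrow>
    (\<exists>B. vec.independent B \<and> card B = Suc h \<and>
      vec.dependent ((\<lambda>a. G *v subfield_vec \<iota> a) ` B))"
proof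
  let ?f = "\<lambda>a. G *v subfield_vec \<iota> a"
  assume "\<not> scattered \<iota> h (associated_system \<iota> G)"
  then obtain T where T: "vec.subspace T" "vec.dim T = h"
    "Suc h \<le> subfield_dim \<iota> (associated_system \<iota> G \<inter> T)"
    by (auto simp: scattered_def not_le Suc_le_eq)
  obtain D where D: "D \<subseteq> {a. ?f a \<in> T}" "vec.independent D" "card D = vec.dim {a. ?f a \<in> T}"
    using vec.basis_exists[of "{a. ?f a \<in> T}"] by metis
  then have "Suc h \<le> card D" using T(3) by (simp add: subfield_dim_associated_system_Int[OF inj T(1)])
  then obtain B where B: "B \<subseteq> D" "card B = Suc h" by (meson obtain_subset_with_card_n)
  have "card (?f ` B) = Suc h" using inj B(2) by (simp add: card_image inj_on_subset)
  then have "vec.dependent (?f ` B)"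
    using vec.independent_card_le_dim[of "?f ` B" T] B(1) D(1) T(2) by auto
  then show "\<exists>B. vec.independent B \<and> card B = Suc h \<and> vec.dependent (?f ` B)"
    using B D(2) vec.independent_mono by blast
next
  let ?f = "\<lambda>a. G *v subfield_vec \<iota> a"
  assume "\<exists>B. vec.independent B \<and> card B = Suc h \<and> vec.dependent (?f ` B)"
  then obtain B where B: "vec.independent B" "card B = Suc h" "vec.dependent (?f ` B)" by blast
  have "card (?f ` B) = Suc h" using inj B(2) by (simp add: card_image inj_on_subset)
  then have "vec.dim (?f ` B) \<le> h"
    using vec.card_le_dim_spanning[of "?f ` B" "?f ` B"] B(3) vec.span_superset
    by (metis finite not_less_eq_eq order_refl)
  then obtain T where T: "vec.subspace T" "?f ` B \<subseteq> T" "vec.dim T = h"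
    using h by (rule vec_subspace_extend_dim)
  have "Suc h \<le> vec.dim {a. ?f a \<in> T}"
    using vec.independent_card_le_dim[of B "{a. ?f a \<in> T}"] B T(2) by auto
  then show "\<not> scattered \<iota> h (associated_system \<iota> G)"
    using T by (auto simp: scattered_def subfield_dim_associated_system_Int[OF inj])
qed

section \<open>Existence of low-weight words by counting\<close>

lemma card_extension: "CARD('l) = CARD('q) ^ ext_degree \<iota>"
proof -
  obtain B where B: "elem.independent B" "UNIV \<subseteq> elem.span B" "card B = elem.dim UNIV"
    using elem.basis_exists by blast
  have "elem.span B = UNIV" using B(2) by auto
  then show ?thesis
    using card_span_independent[OF elem.vector_space_axioms _ B(1)] B(3) by (simp add: ext_degree_def)
qed

text \<open>Pigeonhole: with \<open>W\<close> of F_q-dimension \<open>w\<close>, the product of the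
  sizes of \<open>D\<close> and W^n exceeds that of F_{q^m}^n. Two pairs therefore have the same
  sum, and \<open>x - x' = y' - y\<close> is a nonzero word of \<open>D\<close> with all entries in
  \<open>W\<close>.\<close>

lemma ex_low_weight_word:
  fixes D :: "('l ^ 'n) set"
  assumes D: "vec.subspace D" and w: "w \<le> ext_degree \<iota>"
    and large: "ext_degree \<iota> * CARD('n) < ext_degree \<iota> * vec.dim D + w * CARD('n)"
  shows "\<exists>v\<in>D. v \<noteq> 0 \<and> rank_weight \<iota> v \<le> w"
proof -
  obtain A where A: "elem.independent A" "card A = ext_degree \<iota>"
    using elem.basis_exists[of UNIV] by (auto simp: ext_degree_def)
  obtain A' where A': "A' \<subseteq> A" "card A' = w" using w A(2) by (metis obtain_subset_with_card_n)
  let ?W = "elem.span A'"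
  let ?V = "{v :: 'l ^ 'n. \<forall>i. v $ i \<in> ?W}"
  have "card ?W = CARD('q) ^ w"
    using card_span_independent[OF elem.vector_space_axioms _ elem.independent_mono[OF A(1) A'(1)]] A'(2)
    by simp
  then have cV: "card ?V = CARD('q) ^ (w * CARD('n))"
    by (simp add: card_vec_restricted power_mult)
  obtain B where B: "B \<subseteq> D" "vec.independent B" "D \<subseteq> vec.span B" "card B = vec.dim D"
    using vec.basis_exists by blast
  have "vec.span B = D" using B D by (simp add: vec.span_subspace)
  then have "card D = CARD('l) ^ vec.dim D"
    using card_span_independent[OF vec.vector_space_axioms _ B(2)] B(4) by simp
  then have cD: "card D = CARD('q) ^ (ext_degree \<iota> * vec.dim D)"
    by (simp add: card_extension power_mult)
  have q: "CARD('q) > 1"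
    using card_mono[of UNIV "{0, 1 :: 'q}"] by simp
  have cU: "card (UNIV :: ('l ^ 'n) set) = CARD('q) ^ (ext_degree \<iota> * CARD('n))"
    using card_vec_restricted[of "UNIV :: 'l set", where 'n='n]
    by (simp add: card_extension power_mult)
  have "\<not> inj_on (\<lambda>(x, y). x + y) (D \<times> ?V)"
  proof
    assume "inj_on (\<lambda>(x, y). x + y) (D \<times> ?V)"
    then have "card (D \<times> ?V) \<le> card (UNIV :: ('l ^ 'n) set)"
      by (rule card_inj_on_le) auto
    then have "CARD('q) ^ (ext_degree \<iota> * vec.dim D + w * CARD('n))
        \<le> CARD('q) ^ (ext_degree \<iota> * CARD('n))"
      by (simp only: card_cartesian_product cV cD cU power_add)
    then show False using large q by simp
  qed
  then obtain x y x' y' where xy: "x \<in> D" "x' \<in> D" "y \<in> ?V" "y' \<in> ?V" "x + y = x' + y'"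
      "(x, y) \<noteq> (x', y')"
    by (auto simp: inj_on_def)
  have eq: "x - x' = y' - y" using xy(5) by (simp add: algebra_simps)
  have "(x - x') $ i \<in> ?W" for i
    using xy(3,4) unfolding eq by (auto intro: elem.span_diff)
  then have "elem.dim (range (\<lambda>i. (x - x') $ i)) \<le> card A'"
    by (intro elem.dim_le_card) auto
  then have "rank_weight \<iota> (x - x') \<le> w"
    by (simp add: rank_weight_def A'(2))
  moreover have "x - x' \<noteq> 0" using xy(5,6) by auto
  ultimately show ?thesis using vec.subspace_diff[OF D xy(1,2)] by blast
qed

section \<open>Codeword weights and hyperplane sections\<close>

lemma rank_weight_codeword:
  fixes G :: "'l ^ 'n ^ 'k"
  assumes inj: "inj (\<lambda>a. G *v subfield_vec \<iota> a)"
  shows "subfield_dim \<iota> (associated_system \<iota> G \<inter> {y. scalar_product x y = 0})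
    + rank_weight \<iota> (x v* G) = CARD('n)"
proof -
  \<comment> \<open>Thus \<open>a\<close> annihilates the entries of the codeword iff its image in
    \<open>U\<close> lies in the hyperplane orthogonal to \<open>x\<close>.\<close>
  have "scalar_product (subfield_vec \<iota> a) (x v* G) = scalar_product x (G *v subfield_vec \<iota> a)" for a
    unfolding scalar_product_vector_matrix[symmetric]
    by (simp add: scalar_product_def mult.commute)
  moreover have "vec.subspace {y. scalar_product x y = 0}"
    using module_hom.subspace_kernel[OF Vector_Spaces.linear.axioms(3)[OF linear_scalar_product]] .
  ultimately show ?thesis
    using dim_kernel_plus_rank_weight[of "x v* G"]
    by (simp add: subfield_dim_associated_system_Int[OF inj])
qed

text \<open>Nonzero \<open>x\<close> parametrize both the hyperplanes and the nonzero codewords, so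
  maximizing over the former is minimizing the weight over the latter.\<close>

lemma eps_hyperplanes:
  fixes G :: "'l ^ 'n ^ 'k"
  assumes inj: "inj (\<lambda>a. G *v subfield_vec \<iota> a)"
    and G: "generator_matrix G C" and C: "vec.subspace C"
  shows "eps \<iota> (associated_system \<iota> G) (CARD('k) - 1) =
    int CARD('n) - int (CARD('k) - 1) - int (min_distance \<iota> C)"
proof -
  let ?U = "associated_system \<iota> G" and ?n = "int CARD('n) - int (CARD('k) - 1)"
  let ?H = "\<lambda>x. {y. scalar_product x y = 0}"
  have md: "min_distance \<iota> C = Min (rank_weight \<iota> ` (C - {0}))"
    by (rule min_distance_subspace[OF C])
  have C_eq: "C - {0} = (\<lambda>x. x v* G) ` (- {0})"
    using generator_matrix_range[OF G] generator_matrix_inj[OF G] by auto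
  have ne: "(- {0 :: 'l ^ 'k}) \<noteq> {}"
  proof -
    have "axis undefined 1 \<in> - {0 :: 'l ^ 'k}" by simp
    then show ?thesis by blast
  qed
  have sub: "vec.subspace (?H x)" for x :: "'l ^ 'k"
    using module_hom.subspace_kernel[OF Vector_Spaces.linear.axioms(3)[OF linear_scalar_product]] .
  have val: "eps_space \<iota> ?U (?H x) = ?n - int (rank_weight \<iota> (x v* G))" if "x \<noteq> 0" for x
    using rank_weight_codeword[OF inj, of x] dim_orthogonal_hyperplane[OF that]
    by (simp add: eps_space_def)
  have "{eps_space \<iota> ?U T | T. vec.subspace T \<and> vec.dim T = CARD('k) - 1} =
      (\<lambda>x. ?n - int (rank_weight \<iota> (x v* G))) ` (- {0})" (is "?L = ?R")
  proof
    show "?L \<subseteq> ?R"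
    proof
      fix e assume "e \<in> ?L"
      then obtain T where T: "vec.subspace T" "vec.dim T = CARD('k) - 1" "e = eps_space \<iota> ?U T"
        by blast
      then obtain x where "x \<noteq> 0" "T = ?H x" using hyperplane_eq_orthogonal by blast
      then show "e \<in> ?R" using val T(3) by auto
    qed
    show "?R \<subseteq> ?L"
    proof (rule image_subsetI)
      fix x :: "'l ^ 'k" assume "x \<in> - {0}"
      then have "x \<noteq> 0" by simp
      with sub[of x] dim_orthogonal_hyperplane[of x] val[of x]
      show "?n - int (rank_weight \<iota> (x v* G)) \<in> ?L"
        by (intro CollectI exI[of _ "?H x"]) auto
    qed
  qed
  then have "eps \<iota> ?U (CARD('k) - 1) = Max ?R" by (simp add: eps_def)
  also have "\<dots> = ?n - int (min_distance \<iota> C)"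
  proof (rule Max_eqI)
    fix e assume "e \<in> ?R"
    then obtain x where "x \<noteq> 0" "e = ?n - int (rank_weight \<iota> (x v* G))" by auto
    then show "e \<le> ?n - int (min_distance \<iota> C)"
      unfolding md C_eq by (auto intro!: Min_le)
  next
    \<comment> \<open>The minimum is attained because a nonzero codeword exists.\<close>
    have "Min (rank_weight \<iota> ` (C - {0})) \<in> rank_weight \<iota> ` (C - {0})"
      using ne by (intro Min_in) (auto simp: C_eq)
    then show "?n - int (min_distance \<iota> C) \<in> ?R"
      unfolding md C_eq by auto
  qed simp
  finally show ?thesis .
qed

end

theorem theorem2p20:
  fixes \<iota> :: "'q::{field,finite} \<Rightarrow> 'l::{field,finite}"
    and C :: "('l ^ 'n::finite) set"
    and G :: "'l ^ 'n ^ 'k::finite"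
    and m k \<rho> :: nat
  assumes "field_embedding \<iota>"
    and "ext_degree \<iota> = m"
    and "CARD('k) = k"
    and "k \<ge> 2"
    and "\<rho> \<ge> 1"
    and "real \<rho> < real m / (real k - 1)"
    and "CARD('n) = m + \<rho>"
    and "is_code k C"
    and "nondegenerate TYPE('k) \<iota> C"
    and "nondegenerate TYPE('d::finite) \<iota> (dual_code C)"
    and "generator_matrix G C"
  shows "(quasi_MRD \<iota> C \<longleftrightarrow> eps \<iota> (associated_system \<iota> G) (k - 1) = int \<rho>) \<and>
         (quasi_MRD \<iota> (dual_code C) \<longleftrightarrow> scattered \<iota> (k - 2) (associated_system \<iota> G)) \<and>
         (dually_quasi_MRD \<iota> C \<longleftrightarrow>
            scattered \<iota> (k - 2) (associated_system \<iota> G) \<and>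
            eps \<iota> (associated_system \<iota> G) (k - 1) = int \<rho>)"
proof -
  interpret finite_field_extension \<iota> by unfold_locales (rule assms(1))
  note G = assms(11)
  have inj: "inj (\<lambda>a. G *v subfield_vec \<iota> a)"
    using assms(9) G by (rule nondegenerate_imp_inj)
  have C: "vec.subspace C" "vec.dim C = k" using assms(8) by (auto simp: is_code_def)
  let ?U = "associated_system \<iota> G" and ?D = "dual_code C" and ?n = "m + \<rho>"
  \<comment> \<open>Clearing the positive denominator turns the bound on \<rho> into
    \<open>k * \<rho> < m + \<rho>\<close>, the form in which it enters below.\<close>
  have "real \<rho> * (real k - 1) < real m"
    using assms(4,6) by (simp add: field_simps)
  then have "real (k * \<rho>) < real ?n" by (simp add: algebra_simps)
  then have kn: "k * \<rho> < ?n" by (simp only: of_nat_less_iff)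
  \<comment> \<open>Otherwise \<open>(m + 1) * \<rho> \<le> k * \<rho> < m + \<rho>\<close>,
    impossible for \<open>\<rho> \<ge> 1\<close>. This is what lets F_{q^m} contain a
    \<open>k\<close>-dimensional F_q-subspace.\<close>
  have km: "k \<le> m"
  proof (rule ccontr)
    assume "\<not> k \<le> m"
    then have "(m + 1) * \<rho> \<le> k * \<rho>" by (intro mult_le_mono1) simp
    moreover have "m \<le> m * \<rho>" using assms(5) by simp
    ultimately show False using kn unfolding add_mult_distrib by linarith
  qed
  have kpos: "0 < k * \<rho>" using assms(4,5) by simp
  \<comment> \<open>\<open>k m = k n - k \<rho>\<close> with \<open>0 < k \<rho> < n\<close>: rounding \<open>k m / n\<close> up gives \<open>k\<close>.\<close>
  have kmn: "k * m + k * \<rho> = k * ?n" by (simp add: algebra_simps)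
  have ndvd: "\<not> ?n dvd m * k"
  proof
    assume "?n dvd m * k"
    then have "?n dvd k * \<rho>" using kmn by (metis dvd_add_right_iff dvd_triv_right mult.commute)
    then show False using kn kpos by (meson dvd_imp_le not_le)
  qed
  have "real k * real m + real k * real \<rho> = real k * real ?n"
    using arg_cong[OF kmn, of real] by simp
  moreover have "0 < real k * real \<rho>" "real k * real \<rho> < real ?n"
    using kn kpos by (simp_all flip: of_nat_mult)
  ultimately have bounds: "real k * real ?n - real ?n < real k * real m"
    "real k * real m < real k * real ?n" by linarith+
  have np: "0 < real ?n" using assms(5) by simp
  have ceil: "\<lceil>real (k * m) / real ?n\<rceil> = int k"
    using bounds np by (intro ceiling_unique) (simp_all add: field_simps)
  have "quasi_MRD \<iota> C \<longleftrightarrow> int (min_distance \<iota> C) = int m - int k + 1"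
    using C ndvd ceil assms(2,5,7) by (simp add: quasi_MRD_def Let_def)
  moreover have "eps \<iota> ?U (k - 1) = int ?n - int (k - 1) - int (min_distance \<iota> C)"
    using eps_hyperplanes[OF inj G C(1)] assms(3,7) by simp
  \<comment> \<open>At distance \<open>m - k + 1\<close> the formula gives (m + \<rho>) - (k - 1) -
    (m - k + 1) = \<rho>.\<close>
  ultimately have primal: "quasi_MRD \<iota> C \<longleftrightarrow> eps \<iota> ?U (k - 1) = int \<rho>"
    using assms(4) by auto

  \<comment> \<open>The dual code: parameters, upper bound on the distance, scatteredness\<close>
  have D: "vec.subspace ?D" by (rule subspace_dual_code)
  have dimD: "vec.dim ?D = ?n - k" "k \<le> ?n"
    using dim_dual_code[OF G] assms(3,7) by auto
  have ndvdD: "\<not> ?n dvd m * (?n - k)"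
  proof
    assume "?n dvd m * (?n - k)"
    moreover have "m * (?n - k) + m * k = m * ?n"
      using dimD(2) by (simp flip: add_mult_distrib2)
    ultimately have "?n dvd m * k" by (metis dvd_add_right_iff dvd_triv_right)
    then show False using ndvd by simp
  qed
  \<comment> \<open>The quotient is m - km/n with km/n strictly between k - 1 and k. The quasi-MRD
    distance of the dual is thus m - (m - k + 1) + 1 = k.\<close>
  have ceilD: "\<lceil>real ((?n - k) * m) / real ?n\<rceil> = int m - int k + 1"
  proof (rule ceiling_unique)
    have eq: "real ((?n - k) * m) / real ?n = real m - real k * real m / real ?n"
      using dimD(2) np by (simp add: field_simps)
    show "of_int (int m - int k + 1) - 1 < real ((?n - k) * m) / real ?n"
      unfolding eq using bounds np by (simp add: field_simps)
    show "real ((?n - k) * m) / real ?n \<le> of_int (int m - int k + 1)"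
      unfolding eq using bounds np by (simp add: field_simps)
  qed
  have qD: "quasi_MRD \<iota> ?D \<longleftrightarrow> min_distance \<iota> ?D = k"
    using D ndvdD ceilD assms(2,5,7) dimD(1) by (auto simp: quasi_MRD_def Let_def)
  \<comment> \<open>This is the counting hypothesis for words of weight at most \<open>k\<close>:
    after the common terms cancel it says m < n.\<close>
  have "m * k < k * ?n" using kmn kpos by (simp add: algebra_simps)
  moreover have "m * (?n - k) + m * k = m * ?n"
    using dimD(2) by (simp flip: add_mult_distrib2)
  ultimately have "m * ?n < m * (?n - k) + k * ?n" by linarith
  then obtain v where v: "v \<in> ?D" "v \<noteq> 0" "rank_weight \<iota> v \<le> k"
    using ex_low_weight_word[OF D, of k] km assms(2,7) dimD(1) by auto
  have mdD: "min_distance \<iota> ?D = Min (rank_weight \<iota> ` (?D - {0}))"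
    by (rule min_distance_subspace[OF D])
  have "min_distance \<iota> ?D \<le> k"
    unfolding mdD using v by (meson DiffI Min_le finite finite_imageI image_eqI le_trans singletonD)
  then have "min_distance \<iota> ?D = k \<longleftrightarrow> \<not> min_distance \<iota> ?D \<le> k - 1"
    using assms(4) by linarith
  \<comment> \<open>The word \<open>v\<close> found above makes the set of weights nonempty, so its
    \<open>Min\<close> is meaningful.\<close>
  also have "min_distance \<iota> ?D \<le> k - 1 \<longleftrightarrow> (\<exists>v. G *v v = 0 \<and> v \<noteq> 0 \<and> rank_weight \<iota> v \<le> k - 1)"
    unfolding mdD using v(1,2) by (subst Min_le_iff) (auto simp: dual_code_kernel[OF G])
  also have "\<dots> \<longleftrightarrow> \<not> scattered \<iota> (k - 2) ?U"
  proof -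
    \<comment> \<open>Dual words of weight at most \<open>k - 1\<close> correspond to dependent
      images of \<open>k - 1\<close> vectors, one more than the dimension \<open>k - 2\<close>
      tested by scatteredness.\<close>
    have "Suc (k - 2) = k - 1" using assms(4) by simp
    then show ?thesis
      using low_weight_dual_word_iff[OF inj, of "k - 1"] not_scattered_iff[OF inj, of "k - 2"]
        dimD(2) assms(3,7) by simp
  qed
  finally have "quasi_MRD \<iota> ?D \<longleftrightarrow> scattered \<iota> (k - 2) ?U" using qD by simp
  with primal show ?thesis by (auto simp: dually_quasi_MRD_def)
qed

end
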